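(* Let $n$ be a positive integer and put $k^* = \lfloor \frac{n-4}{6} \rfloor + 1$. Then the sequence $(JL_{n,k})_{0 \le k \le \lfloor n/2 \rfloor}$ is log-concave, i.e. $JL_{n,k}^2 \ge JL_{n,k-1}JL_{n,k+1}$ for all $1 \le k < \lfloor n/2\rfloor$; it is unimodal with $k^*$ as its only mode (the unique index at which the maximum is attained), and it is strictly increasing before the mode: $JL_{n,0} < JL_{n,1} < \cdots < JL_{n,k^*}$.
   Context: For integers $n \ge 1$ and $k \ge 0$, the Jaco-Lucas numbers are $JL_{n,k} = \sum_{i=k}^{\lfloor n/2 \rfloor} \frac{n}{n-i} \binom{n-i}{i} \binom{i}{k}$ (an empty sum, i.e. when $k > \lfloor n/2\rfloor$, equals $0$). A sequence $a_0,\dots,a_m$ of positive numbers is unimodal with mode $j$ if $a_0 \le \cdots \le a_j \ge a_{j+1} \ge \cdots \ge a_m$. *)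

theory Defs
  imports Complex_Main
begin

text \<open>For \<open>1 \<le> n\<close> every index satisfies \<open>i \<le> n div 2 < n\<close>, so the natural-number subtraction
  \<open>n - i\<close> is exact and the denominator is nonzero. The value is real because
  the factor \<open>n / (n - i)\<close> alone need not be an integer.\<close>

definition jaco_lucas :: "nat \<Rightarrow> nat \<Rightarrow> real" where
  "jaco_lucas n k =
     (\<Sum>i = k..n div 2. real n / real (n - i) * real ((n - i) choose i) * real (i choose k))"

text \<open>The predicates below concern the finite sequence \<open>a 0, \<dots>, a m\<close>; values of \<open>a\<close> beyond
  \<open>m\<close> are irrelevant.\<close>

definition log_concave_upto :: "(nat \<Rightarrow> real) \<Rightarrow> nat \<Rightarrow> bool" where
  "log_concave_upto a m \<longleftrightarrow> (\<forall>k. 1 \<le> k \<and> k < m \<longrightarrow> (a k)\<^sup>2 \<ge> a (k - 1) * a (k + 1))"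

definition unimodal_with_mode :: "(nat \<Rightarrow> real) \<Rightarrow> nat \<Rightarrow> nat \<Rightarrow> bool" where
  "unimodal_with_mode a m j \<longleftrightarrow>
     j \<le> m \<and> (\<forall>k\<le>m. 0 < a k) \<and>
     (\<forall>k<j. a k \<le> a (k + 1)) \<and> (\<forall>k. j \<le> k \<and> k < m \<longrightarrow> a k \<ge> a (k + 1))"

text \<open>The subtraction \<open>n - 4\<close> is taken in the reals, so the floor is \<open>-1\<close> and the index is
  \<open>0\<close> for \<open>n = 1, 2, 3\<close>. The argument of \<open>nat\<close> is never negative.\<close>

definition mode_index :: "nat \<Rightarrow> nat" where
  "mode_index n = nat (\<lfloor>(real n - 4) / 6\<rfloor> + 1)"

end

theory Submission
  imports Defs
begin

text \<open>The generating polynomial \<open>\<Sum>i. n/(n-i) * (n-i choose i) * (1+y)^i\<close> satisfies a second order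
  differential equation of Chebyshev type, hence the coefficients \<open>a k = jaco_lucas n k\<close> satisfy a
  three-term recurrence in \<open>k\<close>. Write
  \<open>a (k+1) / a k = (n-2k) * (n-2k-1) / ((k+1) * d k)\<close>; the recurrence becomes
  \<open>d k = 5n - 9k - 7 - 5 * (n-2k-2) * (n-2k-3) / d (k+1)\<close>, which is monotone and contracting when run
  downwards from \<open>k = n div 2 - 1\<close>, where it starts with an explicit value. So affine functions of
  \<open>n\<close> and \<open>k\<close> that are invariant under this map bound \<open>d k\<close>. Asymptotically, with \<open>\<kappa> = k/n\<close>,
  the relevant fixed point is \<open>d/n = (5 - 9\<kappa> + sqrt (5 - 10\<kappa> + \<kappa>^2)) / 2\<close>, and the ratio is \<open>1\<close>
  exactly at \<open>\<kappa> = 1/6\<close>. The square root is concave, so its chord over \<open>[1/6, 1/2]\<close> gives a lower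
  bound for \<open>d\<close> and its tangent at \<open>1/6\<close> an upper bound; the additive constants are fitted so that
  the bounds separate \<open>n \<le> 6k+3\<close> from \<open>n \<ge> 6k+4\<close>.\<close>

section \<open>Coefficients of the Lucas polynomials\<close>

lemma real_Suc_times_choose_Suc:
  "(real k + 1) * real (i choose Suc k) = (real i - real k) * real (i choose k)"
proof (cases "k \<le> i")
  case True
  have "real (Suc k * (i choose Suc k)) = real ((i - k) * (i choose k))"
    using binomial_absorb_comp[of i k] binomial_absorption[of k i]
    by (metis mult.commute choose_mult_lemma binomial_absorption binomial_absorb_comp)
  then show ?thesis using True by (simp add: of_nat_diff algebra_simps)
qed (simp add: binomial_eq_0)

text \<open>The absolute values of the coefficients of the Chebyshev polynomials in Lucas form; for
  \<open>n \<ge> 3\<close> and \<open>i \<le> n div 2\<close> they count the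
  \<open>i\<close>-matchings of an \<open>n\<close>-cycle.\<close>

definition lucas_coeff :: "nat \<Rightarrow> nat \<Rightarrow> real" where
  "lucas_coeff n i = real n / real (n - i) * real ((n - i) choose i)"

lemma lucas_coeff_Suc:
  assumes "Suc i < n"
  shows "(real i + 1) * (real n - real i - 1) * lucas_coeff n (Suc i)
    = (real n - 2 * real i) * (real n - 2 * real i - 1) * lucas_coeff n i"
proof -
  \<comment> \<open>Now \<open>n - Suc i\<close> is \<open>s\<close> and \<open>n - i\<close> is
    \<open>Suc s\<close>, so both coefficients reduce to multiples of
    \<open>s choose i\<close>.\<close>
  obtain s where n: "n = s + i + 1" and s: "s > 0"
    using assms by (metis add.commute add_Suc_right less_imp_add_positive plus_1_eq_Suc add.left_commute)
  have 1: "(real i + 1) * real (s choose Suc i) = (real s - real i) * real (s choose i)"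
    by (rule real_Suc_times_choose_Suc)
  have 2: "(real s + 1 - real i) * real (Suc s choose i) = (real s + 1) * real (s choose i)"
  proof (cases "i \<le> Suc s")
    case True
    have "real ((Suc s - i) * (Suc s choose i)) = real (Suc s * (s choose i))"
      using binomial_absorb_comp[of "Suc s" i] by simp
    then show ?thesis using True by (simp only: of_nat_mult of_nat_diff of_nat_Suc) (simp add: algebra_simps)
  qed (simp add: binomial_eq_0)
  have c0: "lucas_coeff n i = real n / (real s + 1) * real (Suc s choose i)"
    by (simp add: lucas_coeff_def n algebra_simps)
  have c1: "real s * lucas_coeff n (Suc i) = real n * real (s choose Suc i)"
    using s by (simp add: lucas_coeff_def n)
  have "(real i + 1) * (real n - real i - 1) * lucas_coeff n (Suc i)
      = real n * ((real i + 1) * real (s choose Suc i))"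
    using c1 by (simp add: n algebra_simps)
  also have "\<dots> = real n * (real s - real i) * real (s choose i)"
    using 1 by simp
  also have "real (s choose i) = (real s + 1 - real i) * real (Suc s choose i) / (real s + 1)"
    using 2 by (simp add: field_simps)
  finally show ?thesis
    unfolding c0 by (simp add: n algebra_simps)
qed

section \<open>The three-term recurrence in \<open>k\<close>\<close>

lemma jaco_lucas_eq_sum_atMost:
  "jaco_lucas n k = (\<Sum>i\<le>n div 2. lucas_coeff n i * real (i choose k))"
  unfolding jaco_lucas_def lucas_coeff_def
  by (rule sum.mono_neutral_left) auto

lemma jaco_lucas_pos:
  assumes "1 \<le> n" "k \<le> n div 2"
  shows "0 < jaco_lucas n k"
  unfolding jaco_lucas_def
  by (rule sum_pos2[of _ k]) (use assms in auto)

lemma jaco_lucas_eq_0: "n div 2 < k \<Longrightarrow> jaco_lucas n k = 0"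
  by (simp add: jaco_lucas_def)

text \<open>By absorption and \<open>lucas_coeff_Suc\<close>, the subtracted term at
  \<open>Suc i\<close> cancels the positive term at \<open>i\<close>; only the last positive term
  survives.\<close>

lemma telescoped_lucas_sum:
  assumes "M < n"
  shows "(\<Sum>i\<le>M. lucas_coeff n i * ((real n - 2 * real i) * (real n - 2 * real i - 1) * real (i choose k)
      - (real n - real i) * (real k + 1) * real (i choose Suc k)))
    = (real n - 2 * real M) * (real n - 2 * real M - 1) * lucas_coeff n M * real (M choose k)"
  using assms
proof (induction M)
  case (Suc M)
  have *: "(real k + 1) * real (Suc M choose Suc k) = (real M + 1) * real (M choose k)"
    using Suc_times_binomial_eq[of M k] by (metis of_nat_Suc of_nat_mult add.commute mult.commute)
  have "(real n - real (Suc M)) * lucas_coeff n (Suc M) * ((real k + 1) * real (Suc M choose Suc k))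
    = ((real M + 1) * (real n - real M - 1) * lucas_coeff n (Suc M)) * real (M choose k)"
    unfolding * by (simp add: algebra_simps)
  also have "\<dots> = (real n - 2 * real M) * (real n - 2 * real M - 1) * lucas_coeff n M * real (M choose k)"
    using lucas_coeff_Suc[of M n] Suc.prems by simp
  finally show ?case
    using Suc by (simp add: algebra_simps del: binomial_Suc_Suc of_nat_Suc)
qed (simp)

lemma jaco_lucas_recurrence:
  assumes "1 \<le> n"
  shows "(real n - 2 * real k) * (real n - 2 * real k - 1) * jaco_lucas n k
    = (real k + 1) * ((5 * real n - 9 * real k - 7) * jaco_lucas n (k + 1)
        - 5 * (real k + 2) * jaco_lucas n (k + 2))"
proof -
  let ?N = "\<lambda>j. (real n - 2 * real j) * (real n - 2 * real j - 1)"
  \<comment> \<open>The telescoping summand is expanded in \<open>i choose k\<close>,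
    \<open>i choose Suc k\<close>, \<open>i choose Suc (Suc k)\<close>. The coefficients are free of
    \<open>i\<close>, so summation yields values of \<open>jaco_lucas\<close>.\<close>
  have termwise: "?N i * real (i choose k) - (real n - real i) * (real k + 1) * real (i choose Suc k)
    = ?N k * real (i choose k) - (real k + 1) * ((5 * real n - 9 * real k - 7) * real (i choose Suc k)
        - 5 * (real k + 2) * real (i choose Suc (Suc k)))" for i
  proof -
    have b1: "(real k + 1) * real (i choose Suc k) = (real i - real k) * real (i choose k)"
      by (rule real_Suc_times_choose_Suc)
    have b2: "(real k + 2) * real (i choose Suc (Suc k)) = (real i - real k - 1) * real (i choose Suc k)"
      using real_Suc_times_choose_Suc[of "Suc k" i] by (simp add: algebra_simps)
    show ?thesis using b1 b2 by algebra
  qed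
  \<comment> \<open>\<open>n - 2 * (n div 2)\<close> is 0 or 1, so the surviving boundary term
    vanishes.\<close>
  have "?N (n div 2) = 0"
    by (cases "even n") (auto elim!: evenE oddE)
  then have "0 = (\<Sum>i\<le>n div 2. lucas_coeff n i * (?N i * real (i choose k)
      - (real n - real i) * (real k + 1) * real (i choose Suc k)))"
    using telescoped_lucas_sum[of "n div 2" n k] assms by simp
  also have "\<dots> = ?N k * jaco_lucas n k
      - (real k + 1) * ((5 * real n - 9 * real k - 7) * jaco_lucas n (k + 1)
        - 5 * (real k + 2) * jaco_lucas n (k + 2))"
    unfolding termwise jaco_lucas_eq_sum_atMost
    by (simp only: sum_distrib_left flip: sum_subtractf) (rule sum.cong; simp add: algebra_simps)
  finally show ?thesis by simp
qed

section \<open>Propagation of ratio bounds\<close>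

text \<open>In the header's notation: a lower bound \<open>L\<close> for \<open>d\<close> propagates downwards in \<open>k\<close>.\<close>

lemma jaco_lucas_ratio_le:
  fixes n k\<^sub>0 :: nat and L :: "nat \<Rightarrow> real"
  defines "N \<equiv> \<lambda>k. (real n - 2 * real k) * (real n - 2 * real k - 1)"
  assumes n: "1 \<le> n" and k: "k\<^sub>0 \<le> k" "k < n div 2"
    and last: "\<And>k. k\<^sub>0 \<le> k \<Longrightarrow> k + 1 = n div 2 \<Longrightarrow> L k \<le> 5 * real n - 9 * real k - 7"
    and pos: "\<And>k. k\<^sub>0 \<le> k \<Longrightarrow> k + 1 < n div 2 \<Longrightarrow> 0 < L (k + 1)"
    and step: "\<And>k. k\<^sub>0 \<le> k \<Longrightarrow> k + 1 < n div 2
      \<Longrightarrow> 5 * N (k + 1) \<le> (5 * real n - 9 * real k - 7 - L k) * L (k + 1)"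
  shows "(real k + 1) * L k * jaco_lucas n (k + 1) \<le> N k * jaco_lucas n k"
proof -
  let ?P = "\<lambda>k. 5 * real n - 9 * real k - 7"
  have rec: "N k * jaco_lucas n k = (real k + 1) * (?P k * jaco_lucas n (k + 1)
      - 5 * (real k + 2) * jaco_lucas n (k + 2))" for k
    unfolding N_def by (rule jaco_lucas_recurrence[OF n])
  have reduce: "(real k + 1) * L k * jaco_lucas n (k + 1) \<le> N k * jaco_lucas n k"
    if "5 * (real k + 2) * jaco_lucas n (k + 2) \<le> (?P k - L k) * jaco_lucas n (k + 1)" for k
  proof -
    have "(real k + 1) * (L k * jaco_lucas n (k + 1))
        \<le> (real k + 1) * (?P k * jaco_lucas n (k + 1) - 5 * (real k + 2) * jaco_lucas n (k + 2))"
      using that by (intro mult_left_mono) (auto simp: algebra_simps)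
    then show ?thesis using rec[of k] by (simp add: mult.assoc)
  qed
  have "k \<le> n div 2 - 1" using k by simp
  then show ?thesis using k(1)
  proof (induction k rule: inc_induct)
    \<comment> \<open>At the top index \<open>jaco_lucas n (q + 2)\<close> is 0, so the recurrence
      gives \<open>d q = ?P q\<close> exactly.\<close>
    case base
    define q where "q = n div 2 - 1"
    have q: "q + 1 = n div 2" using k by (simp add: q_def)
    have "0 < jaco_lucas n (q + 1)" using jaco_lucas_pos[OF n] q by simp
    moreover have "k\<^sub>0 \<le> q" using base by (simp add: q_def)
    then have "L q \<le> ?P q" using last q by blast
    ultimately have "0 \<le> (?P q - L q) * jaco_lucas n (q + 1)" by simp
    then show ?case using reduce[of q] jaco_lucas_eq_0[of n "q + 2"] q by (simp add: q_def)
  next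
    case (step j)
    have j: "k\<^sub>0 \<le> j" "j + 1 < n div 2" using step by auto
    have a1: "0 < jaco_lucas n (j + 1)" using jaco_lucas_pos[OF n] j by simp
    have IH: "(real j + 2) * L (j + 1) * jaco_lucas n (j + 2) \<le> N (j + 1) * jaco_lucas n (j + 1)"
      using step by (simp add: algebra_simps)
    have "L (j + 1) * (5 * (real j + 2) * jaco_lucas n (j + 2)) \<le> 5 * N (j + 1) * jaco_lucas n (j + 1)"
      using IH by (simp add: algebra_simps)
    also have "\<dots> \<le> (?P j - L j) * L (j + 1) * jaco_lucas n (j + 1)"
      using assms(7)[OF j] a1 by (intro mult_right_mono) auto
    finally have "L (j + 1) * (5 * (real j + 2) * jaco_lucas n (j + 2))
        \<le> L (j + 1) * ((?P j - L j) * jaco_lucas n (j + 1))"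
      by (simp add: mult_ac)
    then have "5 * (real j + 2) * jaco_lucas n (j + 2) \<le> (?P j - L j) * jaco_lucas n (j + 1)"
      using pos[OF j] by (simp only: mult_le_cancel_left_pos)
    then show ?case by (rule reduce)
  qed
qed

text \<open>The map from \<open>d (k + 1)\<close> to \<open>d k\<close> is increasing, so upper
  bounds propagate downwards as well.\<close>

lemma jaco_lucas_ratio_ge:
  fixes n k\<^sub>0 :: nat and U :: "nat \<Rightarrow> real"
  defines "N \<equiv> \<lambda>k. (real n - 2 * real k) * (real n - 2 * real k - 1)"
  assumes n: "1 \<le> n" and k: "k\<^sub>0 \<le> k" "k < n div 2"
    and last: "\<And>k. k\<^sub>0 \<le> k \<Longrightarrow> k + 1 = n div 2 \<Longrightarrow> 5 * real n - 9 * real k - 7 \<le> U k"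
    and pos: "\<And>k. k\<^sub>0 \<le> k \<Longrightarrow> k + 1 < n div 2 \<Longrightarrow> 0 < U (k + 1)"
    and step: "\<And>k. k\<^sub>0 \<le> k \<Longrightarrow> k + 1 < n div 2
      \<Longrightarrow> (5 * real n - 9 * real k - 7 - U k) * U (k + 1) \<le> 5 * N (k + 1)"
  shows "N k * jaco_lucas n k \<le> (real k + 1) * U k * jaco_lucas n (k + 1)"
proof -
  let ?P = "\<lambda>k. 5 * real n - 9 * real k - 7"
  have rec: "N k * jaco_lucas n k = (real k + 1) * (?P k * jaco_lucas n (k + 1)
      - 5 * (real k + 2) * jaco_lucas n (k + 2))" for k
    unfolding N_def by (rule jaco_lucas_recurrence[OF n])
  have reduce: "N k * jaco_lucas n k \<le> (real k + 1) * U k * jaco_lucas n (k + 1)"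
    if "(?P k - U k) * jaco_lucas n (k + 1) \<le> 5 * (real k + 2) * jaco_lucas n (k + 2)" for k
  proof -
    have "(real k + 1) * (?P k * jaco_lucas n (k + 1) - 5 * (real k + 2) * jaco_lucas n (k + 2))
        \<le> (real k + 1) * (U k * jaco_lucas n (k + 1))"
      using that by (intro mult_left_mono) (auto simp: algebra_simps)
    then show ?thesis using rec[of k] by (simp add: mult.assoc)
  qed
  have "k \<le> n div 2 - 1" using k by simp
  then show ?thesis using k(1)
  proof (induction k rule: inc_induct)
    case base
    define q where "q = n div 2 - 1"
    have q: "q + 1 = n div 2" using k by (simp add: q_def)
    have "0 < jaco_lucas n (q + 1)" using jaco_lucas_pos[OF n] q by simp
    moreover have "k\<^sub>0 \<le> q" using base by (simp add: q_def)
    then have "?P q \<le> U q" using last q by blast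
    ultimately have "(?P q - U q) * jaco_lucas n (q + 1) \<le> 0" by (simp add: mult_le_0_iff)
    then show ?case using reduce[of q] jaco_lucas_eq_0[of n "q + 2"] q by (simp add: q_def)
  next
    case (step j)
    have j: "k\<^sub>0 \<le> j" "j + 1 < n div 2" using step by auto
    have a1: "0 < jaco_lucas n (j + 1)" using jaco_lucas_pos[OF n] j by simp
    have IH: "N (j + 1) * jaco_lucas n (j + 1) \<le> (real j + 2) * U (j + 1) * jaco_lucas n (j + 2)"
      using step by (simp add: algebra_simps)
    have "(?P j - U j) * U (j + 1) * jaco_lucas n (j + 1) \<le> 5 * N (j + 1) * jaco_lucas n (j + 1)"
      using assms(7)[OF j] a1 by (intro mult_right_mono) auto
    also have "\<dots> \<le> U (j + 1) * (5 * (real j + 2) * jaco_lucas n (j + 2))"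
      using IH by (simp add: algebra_simps)
    finally have "U (j + 1) * ((?P j - U j) * jaco_lucas n (j + 1))
        \<le> U (j + 1) * (5 * (real j + 2) * jaco_lucas n (j + 2))"
      by (simp add: mult_ac)
    then have "(?P j - U j) * jaco_lucas n (j + 1) \<le> 5 * (real j + 2) * jaco_lucas n (j + 2)"
      using pos[OF j] by (simp only: mult_le_cancel_left_pos)
    then show ?case by (rule reduce)
  qed
qed

section \<open>Strict monotonicity on both sides of the mode\<close>

lemma jaco_lucas_decreasing:
  assumes n: "1 \<le> n" and k: "k < n div 2" and nk: "n \<le> 6 * k + 3"
  shows "jaco_lucas n (k + 1) < jaco_lucas n k"
proof -
  \<comment> \<open>The slope is that of the chord from \<open>k/n = 1/6\<close> to \<open>k/n = 1/2\<close>.\<close>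
  define L where "L j = (15 * real n - 26 * real j - 20) / 4" for j
  define N where "N j = (real n - 2 * real j) * (real n - 2 * real j - 1)" for j
  have "(real k + 1) * L k * jaco_lucas n (k + 1) \<le> N k * jaco_lucas n k"
    unfolding N_def
  proof (rule jaco_lucas_ratio_le[OF n order_refl k])
    fix j assume j: "k \<le> j" "j + 1 = n div 2"
    then have "real n \<ge> 2 * real j + 2" by linarith
    then show "L j \<le> 5 * real n - 9 * real j - 7" by (simp add: L_def)
  next
    fix j assume j: "k \<le> j" "j + 1 < n div 2"
    then have "real n \<ge> 2 * real j + 4" by linarith
    then show "0 < L (j + 1)" by (simp add: L_def)
  next
    fix j assume j: "k \<le> j" "j + 1 < n div 2"
    define e where "e = real n - 2 * real j"
    have e: "e \<ge> 4" "e \<le> 4 * real j + 3" using j nk by (simp_all add: e_def)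
    have n_eq: "real n = e + 2 * real j" by (simp add: e_def)
    \<comment> \<open>The factor \<open>5 * n - 9 * j - 7 - L j\<close> is
      \<open>5/4 * (e - 8/5)\<close>, and \<open>j \<ge> (e - 3) / 4\<close> bounds
      \<open>L (j + 1)\<close> below by \<open>4 * e - 49/4\<close>. An inequality in
      \<open>e\<close> alone remains.\<close>
    have "(e - 8/5) * (4 * e - 49/4) \<le> (e - 8/5) * (15/4 * e + real j - 23/2)"
      using e by (intro mult_left_mono) auto
    moreover have "4 * ((e - 2) * (e - 3)) \<le> (e - 8/5) * (4 * e - 49/4)"
      using e by (simp add: field_simps)
    ultimately show "5 * ((real n - 2 * real (j + 1)) * (real n - 2 * real (j + 1) - 1))
        \<le> (5 * real n - 9 * real j - 7 - L j) * L (j + 1)"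
      unfolding L_def n_eq by (simp add: field_simps)
  qed
  also have "N k * jaco_lucas n k < (real k + 1) * L k * jaco_lucas n k"
  proof (rule mult_strict_right_mono)
    show "0 < jaco_lucas n k" using jaco_lucas_pos[OF n] k by simp
    define e where "e = real n - 2 * real k"
    have e: "e \<ge> 2" "e \<le> 4 * real k + 3" using k nk by (simp_all add: e_def)
    have n_eq: "real n = e + 2 * real k" by (simp add: e_def)
    \<comment> \<open>\<open>4 * ((k + 1) * L k - N k)\<close> equals
      \<open>(4 * e + k - 7) * (4 * k + 3 - e) + 9 * k + 1\<close>.\<close>
    have "(e - 2) * (4 * real k + 3 - e) \<ge> 0" using e by simp
    moreover have "real k * (e - 2) \<ge> 0" "real k * (4 * real k + 3 - e) \<ge> 0" "real k * real k \<ge> 0"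
      using e by simp_all
    ultimately show "N k < (real k + 1) * L k"
      unfolding N_def L_def n_eq using e by (simp add: field_simps)
  qed
  finally have "((real k + 1) * L k) * jaco_lucas n (k + 1) < ((real k + 1) * L k) * jaco_lucas n k" .
  moreover have "0 < (real k + 1) * L k"
  proof -
    have "real n \<ge> 2 * real k + 2" using k by linarith
    then have "0 < L k" by (simp add: L_def)
    then show ?thesis by simp
  qed
  ultimately show ?thesis by (simp only: mult_less_cancel_left_pos)
qed

lemma jaco_lucas_increasing:
  assumes nk: "6 * k + 4 \<le> n"
  shows "jaco_lucas n k < jaco_lucas n (k + 1)"
proof -
  have n: "1 \<le> n" and k: "k < n div 2" using nk by auto
  \<comment> \<open>The slope is that of the tangent at \<open>k/n = 1/6\<close>.\<close>
  define U where "U j = (40 * real n - 64 * real j - 33) / 11" for j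
  define N where "N j = (real n - 2 * real j) * (real n - 2 * real j - 1)" for j
  have a1: "0 < jaco_lucas n (k + 1)" using jaco_lucas_pos[OF n] k by simp
  define e where "e = real n - 2 * real k"
  have e: "e \<ge> 4 * real k + 4" using nk by (simp add: e_def)
  have n_eq: "real n = e + 2 * real k" by (simp add: e_def)
  have "N k * jaco_lucas n k \<le> (real k + 1) * U k * jaco_lucas n (k + 1)"
    unfolding N_def
  proof (rule jaco_lucas_ratio_ge[OF n order_refl k])
    fix j assume j: "k \<le> j" "j + 1 = n div 2"
    \<comment> \<open>For \<open>n = 2 * j + 3\<close> the claim amounts to
      \<open>0 \<le> 5 * j - 1\<close>, which is why \<open>1 \<le> j\<close> is extracted.\<close>
    then have "n \<le> 2 * j + 3" "1 \<le> j" using nk by linarith+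
    then have "real n \<le> 2 * real j + 3" "1 \<le> real j" by linarith+
    then show "5 * real n - 9 * real j - 7 \<le> U j" by (simp add: U_def)
  next
    fix j assume j: "k \<le> j" "j + 1 < n div 2"
    then have "real n \<ge> 2 * real j + 4" by linarith
    then show "0 < U (j + 1)" by (simp add: U_def)
  next
    fix j assume j: "k \<le> j" "j + 1 < n div 2"
    define d where "d = real n - 2 * real j"
    have d: "d \<ge> 4" using j by (simp add: d_def)
    have n_eq: "real n = d + 2 * real j" by (simp add: d_def)
    \<comment> \<open>This is 121 times the slack in the step condition; the square vanishes at
      \<open>n = 6 * j\<close>, where the tangent touches.\<close>
    have "605 * ((d - 2) * (d - 3)) - (15 * d - 5 * real j - 44) * (40 * d + 16 * real j - 97)
        = 5 * (d - 4 * real j)\<^sup>2 + 190 * d + 219 * real j - 638"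
      by (simp add: algebra_simps power2_eq_square)
    moreover have "\<dots> \<ge> 0" using d zero_le_power2[of "d - 4 * real j"] by linarith
    ultimately show "(5 * real n - 9 * real j - 7 - U j) * U (j + 1)
        \<le> 5 * ((real n - 2 * real (j + 1)) * (real n - 2 * real (j + 1) - 1))"
      unfolding U_def n_eq by (simp add: field_simps)
  qed
  also have "\<dots> < N k * jaco_lucas n (k + 1)"
  proof (rule mult_strict_right_mono[OF _ a1])
    \<comment> \<open>\<open>11 * (N k - (k + 1) * U k)\<close> equals
      \<open>(e - 4 * k - 4) * (11 * e + 4 * k - 7) + 5 * k + 5\<close>.\<close>
    have "(e - 4 * real k - 4) * (11 * e - 11) \<ge> 0" "(e - 4 * real k - 4) * real k \<ge> 0"
      using e by (intro mult_nonneg_nonneg; simp)+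
    then show "(real k + 1) * U k < N k"
      unfolding N_def U_def n_eq using e by (simp add: field_simps)
  qed
  finally have "N k * jaco_lucas n k < N k * jaco_lucas n (k + 1)" .
  moreover have "0 < N k" unfolding N_def n_eq using e by simp
  ultimately show ?thesis by (simp only: mult_less_cancel_left_pos)
qed

section \<open>Log-concavity and the mode index\<close>

text \<open>This bound serves log-concavity and holds on both sides of the mode. Its
  \<open>L\<close> shares the factor \<open>n - 2 * k - 1\<close> with the left-hand polynomial of
  the recurrence, so the step condition becomes linear.\<close>

lemma jaco_lucas_ratio_crude:
  assumes n: "1 \<le> n" and k: "k < n div 2"
  shows "5 * (real k + 1) * jaco_lucas n (k + 1) \<le> 2 * (real n - 2 * real k) * jaco_lucas n k"
proof -
  define L where "L j = 5 / 2 * (real n - 2 * real j - 1)" for j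
  have "(real k + 1) * L k * jaco_lucas n (k + 1)
      \<le> (real n - 2 * real k) * (real n - 2 * real k - 1) * jaco_lucas n k"
  proof (rule jaco_lucas_ratio_le[OF n order_refl k])
    fix j assume j: "k \<le> j" "j + 1 = n div 2"
    then have "real n \<ge> 2 * real j + 2" by linarith
    then show "L j \<le> 5 * real n - 9 * real j - 7" by (simp add: L_def)
  next
    fix j assume j: "k \<le> j" "j + 1 < n div 2"
    then have "real n \<ge> 2 * real j + 4" by linarith
    then show "0 < L (j + 1)" by (simp add: L_def)
  next
    fix j assume j: "k \<le> j" "j + 1 < n div 2"
    then have ge: "real n \<ge> 2 * real j + 4" by linarith
    have "5 * (real n - 2 * real (j + 1)) * (real n - 2 * real (j + 1) - 1)
        = 2 * (real n - 2 * real (j + 1)) * L (j + 1)"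
      by (simp add: L_def algebra_simps)
    also have "\<dots> \<le> (5 * real n - 9 * real j - 7 - L j) * L (j + 1)"
      using ge by (intro mult_right_mono) (auto simp: L_def field_simps)
    finally show "5 * ((real n - 2 * real (j + 1)) * (real n - 2 * real (j + 1) - 1))
        \<le> (5 * real n - 9 * real j - 7 - L j) * L (j + 1)" by (simp only: mult.assoc)
  qed
  then have "(real n - 2 * real k - 1) * (5 * (real k + 1) * jaco_lucas n (k + 1))
      \<le> (real n - 2 * real k - 1) * (2 * (real n - 2 * real k) * jaco_lucas n k)"
    by (simp add: L_def field_simps)
  moreover have "0 < real n - 2 * real k - 1" using k by linarith
  ultimately show ?thesis by (simp only: mult_le_cancel_left_pos)
qed

lemma mode_index_eq: "1 \<le> n \<Longrightarrow> mode_index n = (n + 2) div 6"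
proof -
  have "(real n - 4) / 6 = real_of_int (int n - 4) / real_of_int 6" by simp
  then have "\<lfloor>(real n - 4) / 6\<rfloor> = (int n - 4) div 6"
    by (simp only: floor_divide_of_int_eq)
  then have "mode_index n = nat ((int n - 4) div 6 + 1)" by (simp add: mode_index_def)
  then show ?thesis by linarith
qed

text \<open>Downward induction again: the induction hypothesis replaces \<open>C\<^sup>2\<close> by \<open>B * D\<close> in the recurrence
  for \<open>A * C\<close>, and the crude bound on \<open>D / C\<close> then suffices.\<close>

lemma jaco_lucas_log_concave:
  assumes n: "1 \<le> n" and k: "k < n div 2"
  shows "jaco_lucas n k * jaco_lucas n (k + 2) \<le> (jaco_lucas n (k + 1))\<^sup>2"
proof -
  have "k \<le> n div 2 - 1" using k by simp
  then show ?thesis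
  proof (induction k rule: inc_induct)
    case base
    then show ?case using jaco_lucas_eq_0[of n "n div 2 - 1 + 2"] by simp
  next
    case (step j)
    have j: "j + 2 \<le> n div 2" using step by simp
    define A B C D where "A = jaco_lucas n j" and "B = jaco_lucas n (j + 1)"
      and "C = jaco_lucas n (j + 2)" and "D = jaco_lucas n (j + 3)"
    have B: "0 < B" and C: "0 < C"
      using jaco_lucas_pos[OF n] j by (simp_all add: B_def C_def)
    have IH: "B * D \<le> C\<^sup>2" using step by (simp add: B_def C_def D_def eval_nat_numeral)
    define t where "t = real j"
    define e where "e = real n - 2 * t"
    have t: "0 \<le> t" by (simp add: t_def)
    have e: "4 \<le> e" using j by (simp add: e_def t_def)
    have n_eq: "real n = e + 2 * t" by (simp add: e_def)
    have rec0: "e * (e - 1) * A = (t + 1) * ((5 * e + t - 7) * B - 5 * (t + 2) * C)"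
      using jaco_lucas_recurrence[OF n, of j]
      by (simp add: A_def B_def C_def n_eq algebra_simps flip: t_def)
    have rec1: "(e - 2) * (e - 3) * B = (t + 2) * ((5 * e + t - 16) * C - 5 * (t + 3) * D)"
      using jaco_lucas_recurrence[OF n, of "j + 1"]
      by (simp add: B_def C_def D_def n_eq algebra_simps eval_nat_numeral flip: t_def)
    have crude: "5 * (t + 3) * D \<le> 2 * (e - 4) * C"
    proof (cases "j + 2 = n div 2")
      case True
      then have "D = 0" using jaco_lucas_eq_0[of n "j + 3"] by (simp add: D_def)
      then show ?thesis using e C by simp
    next
      case False
      then show ?thesis
        using jaco_lucas_ratio_crude[OF n, of "j + 2"] j
        by (simp add: C_def D_def n_eq algebra_simps eval_nat_numeral flip: t_def)
    qed
    \<comment> \<open>Substituting \<open>rec1\<close> for \<open>B\<close> turns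
      \<open>key\<close>, scaled by \<open>(t + 3) * (e - 2) * (e - 3)\<close>, into
      \<open>5 * (t + 2) * (t + 3) * Q * D \<le> R * C\<close>. By \<open>crude\<close>, it suffices
      that \<open>2 * (e - 4) * (t + 2) * Q \<le> R\<close>.\<close>
    define Q where "Q = (t + 3) * (e * (e - 1)) - (t + 1) * ((e - 2) * (e - 3))"
    \<comment> \<open>In \<open>t\<close> and \<open>f\<close> the polynomials to be shown
      nonnegative have only positive coefficients.\<close>
    define f where "f = e - 4"
    have f: "0 \<le> f" and e_eq: "e = f + 4" using e by (simp_all add: f_def)
    have "Q = 34 + 18 * f + 2 * f\<^sup>2 + 10 * t + 4 * (t * f)"
      unfolding Q_def e_eq by (simp add: algebra_simps power2_eq_square)
    then have Q: "0 \<le> Q" using t f by simp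
    define R where "R = (t + 3) * (t + 2) * e * (e - 1) * (5 * e + t - 16)
      - (t + 1) * (t + 3) * (e - 2) * (e - 3) * (5 * e + t - 7)"
    have R: "2 * (e - 4) * (t + 2) * Q \<le> R"
    proof -
      have "R - 2 * (e - 4) * (t + 2) * Q
          = 210 + 245 * f + 78 * f^2 + 7 * f^3 + t * (202 + 169 * f + 34 * f^2 + f^3)
            + t^2 * (74 + 42 * f + 4 * f^2) + t^3 * (10 + 4 * f)"
        unfolding Q_def R_def e_eq by (simp add: algebra_simps power2_eq_square power3_eq_cube)
      also have "\<dots> \<ge> 0" using t f by simp
      finally show ?thesis by simp
    qed
    have "(t + 2) * Q * (5 * (t + 3) * D) \<le> (t + 2) * Q * (2 * (e - 4) * C)"
      using crude t Q by (intro mult_left_mono) auto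
    also have "\<dots> \<le> R * C"
      using mult_right_mono[OF R, of C] C by (simp add: mult_ac)
    finally have "(t + 3) * ((e - 2) * (e - 3) * ((t + 1) * ((5 * e + t - 7) * C - 5 * (t + 2) * D)))
        \<le> (t + 3) * (e * (e - 1) * ((t + 2) * ((5 * e + t - 16) * C - 5 * (t + 3) * D)))"
      unfolding Q_def R_def by (simp add: algebra_simps)
    also have "\<dots> = (t + 3) * ((e - 2) * (e - 3) * (e * (e - 1) * B))"
      unfolding rec1[symmetric] by (simp add: mult_ac)
    finally have key: "(t + 1) * ((5 * e + t - 7) * C - 5 * (t + 2) * D) \<le> e * (e - 1) * B"
      using t e by (simp add: mult_le_cancel_left_pos)
    have "e * (e - 1) * (A * C) = (t + 1) * ((5 * e + t - 7) * (B * C) - 5 * (t + 2) * C\<^sup>2)"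
      using arg_cong[OF rec0, of "\<lambda>x. x * C"] by (simp add: algebra_simps power2_eq_square)
    also have "\<dots> \<le> (t + 1) * ((5 * e + t - 7) * (B * C) - 5 * (t + 2) * (B * D))"
      using IH t by (intro mult_left_mono diff_left_mono) auto
    also have "\<dots> = (t + 1) * ((5 * e + t - 7) * C - 5 * (t + 2) * D) * B"
      by (simp add: algebra_simps)
    also have "\<dots> \<le> e * (e - 1) * B * B"
      using key B by (intro mult_right_mono) auto
    finally have "(e * (e - 1)) * (A * C) \<le> (e * (e - 1)) * B\<^sup>2"
      by (simp add: power2_eq_square mult.assoc)
    moreover have "0 < e * (e - 1)" using e by simp
    ultimately show ?case by (simp only: mult_le_cancel_left_pos A_def B_def C_def)
  qed
qed

theorem theorem1p1:
  fixes n :: nat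
  assumes "1 \<le> n"
  shows "log_concave_upto (jaco_lucas n) (n div 2)
    \<and> unimodal_with_mode (jaco_lucas n) (n div 2) (mode_index n)
    \<and> (\<forall>j. unimodal_with_mode (jaco_lucas n) (n div 2) j \<longrightarrow> j = mode_index n)
    \<and> (\<forall>k\<le>n div 2. k \<noteq> mode_index n \<longrightarrow> jaco_lucas n k < jaco_lucas n (mode_index n))
    \<and> (\<forall>k<mode_index n. jaco_lucas n k < jaco_lucas n (k + 1))"
proof (intro conjI)
  let ?a = "jaco_lucas n" and ?m = "n div 2" and ?j = "mode_index n"
  have mode: "?j = (n + 2) div 6" by (rule mode_index_eq[OF assms])
  have mode_le: "?j \<le> ?m" unfolding mode using assms by linarith
  have inc: "?a k < ?a (k + 1)" if "k < ?j" for k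
    by (rule jaco_lucas_increasing) (use that mode in linarith)
  have dec: "?a (k + 1) < ?a k" if "?j \<le> k" "k < ?m" for k
    by (rule jaco_lucas_decreasing[OF assms that(2)]) (use that mode in linarith)
  show "log_concave_upto ?a ?m"
    unfolding log_concave_upto_def
  proof (intro allI impI)
    fix k assume "1 \<le> k \<and> k < ?m"
    then show "?a (k - 1) * ?a (k + 1) \<le> (?a k)\<^sup>2"
      using jaco_lucas_log_concave[OF assms, of "k - 1"] by (cases k) auto
  qed
  show "unimodal_with_mode ?a ?m ?j"
    unfolding unimodal_with_mode_def
    using mode_le jaco_lucas_pos[OF assms] inc dec by (auto intro: less_imp_le)
  show "\<forall>j. unimodal_with_mode ?a ?m j \<longrightarrow> j = ?j"
  proof (intro allI impI)
    fix j assume j: "unimodal_with_mode ?a ?m j"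
    show "j = ?j"
    proof (rule linorder_cases)
      assume "j < ?j"
      then show ?thesis using j inc[of j] mode_le by (force simp: unimodal_with_mode_def)
    next
      assume "?j < j"
      then show ?thesis using j dec[of ?j] by (force simp: unimodal_with_mode_def)
    qed
  qed
  show "\<forall>k<?j. ?a k < ?a (k + 1)" using inc by blast
  show "\<forall>k\<le>?m. k \<noteq> ?j \<longrightarrow> ?a k < ?a ?j"
  proof (intro allI impI)
    fix k assume k: "k \<le> ?m" "k \<noteq> ?j"
    show "?a k < ?a ?j"
    proof (cases "k < ?j")
      case True
      \<comment> \<open>Strict steps chain upwards to the mode here, and downwards from it in the
        other case.\<close>
      then show ?thesis
      proof (induction rule: strict_inc_induct)
        case (base i)
        then show ?case using inc[of i] by simp
      next
        case (step i)
        then show ?case using inc[of i] by simp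
      qed
    next
      case False
      then have "Suc ?j \<le> k" using k by simp
      then show ?thesis using k(1)
      proof (induction k rule: dec_induct)
        case base
        then show ?case using dec[of ?j] by simp
      next
        case (step i)
        then show ?case using dec[of i] by simp
      qed
    qed
  qed
qed

end
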